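(* The set MNF is closed under prefixing ordinal modalities modulo $\mathbf{TSC}$-equivalence: for every $\psi\in\mathrm{MNF}$, every $n<\omega$ and every $\alpha<\varepsilon_0$, there is $\psi'\in\mathrm{MNF}$ with $\langle n^\alpha\rangle\psi\equiv\psi'$.
   Context: Ordinals range below $\varepsilon_0$. $\mathbb{F}_{\varepsilon_0}$ is the least set containing $\top$, closed under $\wedge$ and under unary modalities $\langle n^\alpha\rangle$ ($n<\omega$, $\alpha<\varepsilon_0$); $\langle n^0\rangle\varphi$ denotes $\varphi$. Hyper-exponentials: $e^0=\mathrm{id}$, $e^1(\alpha)=-1+\omega^\alpha$, $e^{n+m}=e^n\circ e^m$. MNF is the least set with: $\top\in$ MNF; each monomial $\langle n^\alpha\rangle\top\in$ MNF; if $\langle n_0^{\alpha_0}\rangle\top\wedge\cdots\wedge\langle n_k^{\alpha_k}\rangle\top\in$ MNF, $n<n_0$, and $\alpha=e^{n_0-n}(\alpha_0)\cdot(2+\beta)$ for some $\beta<\varepsilon_0$, then $\langle n^\alpha\rangle\top\wedge\langle n_0^{\alpha_0}\rangle\top\wedge\cdots\wedge\langle n_k^{\alpha_k}\rangle\top\in$ MNF. $\mathbf{TSC}$ derives sequents $\varphi\vdash\psi$; $\varphi\equiv\psi$ means both directions derivable. Axioms: $\varphi\vdash\varphi$; $\varphi\vdash\top$; $\varphi\wedge\psi\vdash\varphi$; $\varphi\wedge\psi\vdash\psi$; $\langle n^\alpha\rangle\varphi\vdash\langle n^\beta\rangle\varphi$ for $\beta\le\alpha$; $\langle n^{\alpha+\beta}\rangle\varphi\equiv\langle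 n^\beta\rangle\langle n^\alpha\rangle\varphi$; $\langle(m+n)^\alpha\rangle\varphi\vdash\langle m^{e^n(\alpha)}\rangle\varphi$; Schmerl axioms $\langle n^\alpha\rangle(\langle n_0^{\alpha_0}\rangle\top\wedge\cdots\wedge\langle n_k^{\alpha_k}\rangle\top)\equiv\langle n^{e^{n_0-n}(\alpha_0)\cdot(1+\alpha)}\rangle\top\wedge\langle n_0^{\alpha_0}\rangle\top\wedge\cdots\wedge\langle n_k^{\alpha_k}\rangle\top$ for $n<n_0$ and the conjunction in MNF. Rules: from $\varphi\vdash\psi$, $\varphi\vdash\chi$ infer $\varphi\vdash\psi\wedge\chi$; from $\varphi\vdash\psi$, $\psi\vdash\chi$ infer $\varphi\vdash\chi$; from $\varphi\vdash\psi$ infer $\langle n^\alpha\rangle\varphi\vdash\langle n^\alpha\rangle\psi$; from $\varphi\vdash\psi$ infer $\langle n^\alpha\rangle\varphi\wedge\langle m^{\beta+1}\rangle\psi\vdash\langle n^\alpha\rangle(\varphi\wedge\langle m^{\beta+1}\rangle\psi)$ for $m<n$. *)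

theory Defs
  imports Main
begin

section \<open>Ordinals below epsilon zero\<close>

text \<open>
  Cantor normal forms: \<open>OZero\<close> is \<open>0\<close> and \<open>OSum a b\<close> is \<open>\<omega>\<^sup>a + b\<close>, a normal form if
  \<open>a\<close> is at least the leading exponent of \<open>b\<close>. The type \<open>ordE\<close> of normal forms
  represents each ordinal below epsilon zero exactly once.
\<close>

datatype cnf = OZero | OSum cnf cnf

instantiation cnf :: linorder
begin

fun less_cnf :: "cnf \<Rightarrow> cnf \<Rightarrow> bool" where
  "less_cnf x OZero = False"
| "less_cnf OZero (OSum c d) = True"
| "less_cnf (OSum a b) (OSum c d) = (less_cnf a c \<or> a = c \<and> less_cnf b d)"

definition less_eq_cnf :: "cnf \<Rightarrow> cnf \<Rightarrow> bool" where
  "less_eq_cnf x y \<longleftrightarrow> x < y \<or> x = (y::cnf)"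

instance
proof
  have irr: "\<not> x < x" for x :: cnf
    by (induction x) auto
  have tr: "x < y \<Longrightarrow> y < z \<Longrightarrow> x < z" for x y z :: cnf
  proof (induction x arbitrary: y z)
    case OZero
    then show ?case by (cases y; cases z) auto
  next
    case (OSum a b)
    then show ?case by (cases y; cases z) auto
  qed
  have tot: "x < y \<or> x = y \<or> y < x" for x y :: cnf
  proof (induction x arbitrary: y)
    case OZero
    then show ?case by (cases y) auto
  next
    case (OSum a b)
    then show ?case by (cases y) auto
  qed
  fix x y z :: cnf
  show "x < y \<longleftrightarrow> x \<le> y \<and> \<not> y \<le> x"
    unfolding less_eq_cnf_def using irr tr by metis
  show "x \<le> x"
    unfolding less_eq_cnf_def by blast
  show "x \<le> y \<Longrightarrow> y \<le> z \<Longrightarrow> x \<le> z"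
    unfolding less_eq_cnf_def using tr by metis
  show "x \<le> y \<Longrightarrow> y \<le> x \<Longrightarrow> x = y"
    unfolding less_eq_cnf_def using irr tr by metis
  show "x \<le> y \<or> y \<le> x"
    unfolding less_eq_cnf_def using tot by metis
qed

end

fun lead_le :: "cnf \<Rightarrow> cnf \<Rightarrow> bool" where
  "lead_le OZero a = True"
| "lead_le (OSum c d) a = (c \<le> a)"

fun nf :: "cnf \<Rightarrow> bool" where
  "nf OZero = True"
| "nf (OSum a b) = (nf a \<and> nf b \<and> lead_le b a)"

fun cnf_add :: "cnf \<Rightarrow> cnf \<Rightarrow> cnf" where
  "cnf_add OZero y = y"
| "cnf_add (OSum a b) OZero = OSum a b"
| "cnf_add (OSum a b) (OSum c d) =
     (if a < c then OSum c d else OSum a (cnf_add b (OSum c d)))"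

text \<open>Multiplication from the right by \<open>\<omega>\<^sup>c\<close>.\<close>

fun cnf_mult_pow :: "cnf \<Rightarrow> cnf \<Rightarrow> cnf" where
  "cnf_mult_pow OZero c = OZero"
| "cnf_mult_pow (OSum a b) c = (if c = OZero then OSum a b else OSum (cnf_add a c) OZero)"

fun cnf_mult :: "cnf \<Rightarrow> cnf \<Rightarrow> cnf" where
  "cnf_mult x OZero = OZero"
| "cnf_mult x (OSum c d) = cnf_add (cnf_mult_pow x c) (cnf_mult x d)"

lemma not_less_OZero [simp]: "\<not> x < OZero"
  by (cases x) auto

lemma OZero_le [simp]: "OZero \<le> x"
  by (simp add: not_less [symmetric])

lemma cnf_add_OZero [simp]: "cnf_add x OZero = x"
  by (cases x) auto

lemma lead_le_add: "lead_le x a \<Longrightarrow> lead_le y a \<Longrightarrow> lead_le (cnf_add x y) a"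
  by (cases x; cases y) auto

lemma nf_add: "nf x \<Longrightarrow> nf y \<Longrightarrow> nf (cnf_add x y)"
proof (induction x)
  case (OSum a b)
  then show ?case by (cases y) (auto intro!: lead_le_add simp: not_less)
qed auto

lemma nf_mult: "nf x \<Longrightarrow> nf y \<Longrightarrow> nf (cnf_mult x y)"
proof (induction y)
  case (OSum c d)
  then show ?case by (cases x) (auto intro!: nf_add)
qed auto

lemma cnf_add_assoc: "cnf_add (cnf_add x y) z = cnf_add x (cnf_add y z)"
proof (induction x)
  case (OSum a b)
  then show ?case by (cases y; cases z) auto
qed auto

lemma cnf_add_strict_mono: "y < z \<Longrightarrow> cnf_add x y < cnf_add x z"
proof (induction x)
  case (OSum a b)
  then show ?case by (cases y; cases z) auto
qed auto

lemma lead_le_addD: "lead_le (cnf_add x y) a \<Longrightarrow> lead_le y a"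
  by (cases x; cases y) (auto split: if_splits)

lemma cnf_le_imp_add:
  "nf x \<Longrightarrow> nf y \<Longrightarrow> x \<le> y \<Longrightarrow> \<exists>z. nf z \<and> y = cnf_add x z"
proof (induction x arbitrary: y)
  case (OSum a b)
  from OSum.prems obtain c d where y: "y = OSum c d"
    by (cases y) (auto simp: not_less [symmetric])
  show ?case
  proof (cases "a < c")
    case True
    then show ?thesis using y OSum.prems by (intro exI [of _ y]) auto
  next
    case False
    with OSum.prems y have "a = c" "b \<le> d" by (auto simp: less_eq_cnf_def)
    with OSum y obtain z where z: "nf z" "d = cnf_add b z" by auto
    with OSum.prems y \<open>a = c\<close> have "lead_le z a" using lead_le_addD by auto
    then have "y = cnf_add (OSum a b) z"
      using z y \<open>a = c\<close> by (cases z) auto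
    with z show ?thesis by blast
  qed
qed auto

lemma wf_cnf: "wf {(x, y). nf x \<and> nf y \<and> x < y}" (is "wf ?R")
proof -
  let ?A = "\<lambda>x. nf x \<longrightarrow> x \<in> Wellfounded.acc ?R"
  have zero: "?A OZero" by (auto intro: accI)
  have main: "\<forall>b. nf (OSum a b) \<longrightarrow> OSum a b \<in> Wellfounded.acc ?R"
    if "nf a" "a \<in> Wellfounded.acc ?R" for a
    using that(2,1)
  proof (induction a rule: acc_induct_rule)
    case (1 a)
    have step: "OSum a b \<in> Wellfounded.acc ?R" if "b \<in> Wellfounded.acc ?R" "nf (OSum a b)" for b
      using that
    proof (induction b rule: acc_induct_rule)
      case (1 b)
      show ?case
      proof (rule accI)
        fix x assume "(x, OSum a b) \<in> ?R"
        then have x: "nf x" "x < OSum a b" by auto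
        show "x \<in> Wellfounded.acc ?R"
        proof (cases x)
          case OZero then show ?thesis using zero by simp
        next
          case (OSum c d)
          then consider "c < a" | "c = a" "d < b" using x by auto
          then show ?thesis
          proof cases
            case 1
            then show ?thesis using x OSum \<open>nf a\<close>
              "1.prems" \<open>\<And>y. (y, a) \<in> ?R \<Longrightarrow> nf y \<Longrightarrow> \<forall>b. nf (OSum y b) \<longrightarrow> OSum y b \<in> Wellfounded.acc ?R\<close>
              by auto
          next
            case 2
            then show ?thesis using "1.IH" [of d] x OSum "1.prems" by auto
          qed
        qed
      qed
    qed
    have "b \<in> Wellfounded.acc ?R" if "nf b" "lead_le b a" for b
      using that
    proof (induction b)
      case OZero then show ?case using zero by simp
    next
      case (OSum c d)
      have "lead_le d a" using OSum.prems by (cases d) auto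
      then have d: "d \<in> Wellfounded.acc ?R" using OSum by auto
      show ?case
      proof (cases "c = a")
        case True then show ?thesis using step [OF d] OSum.prems by auto
      next
        case False
        then show ?thesis using "1.IH" [of c] OSum.prems \<open>nf a\<close> by auto
      qed
    qed
    then show ?case using step by auto
  qed
  have "?A x" for x
    by (induction x) (use zero main in auto)
  moreover have "x \<in> Wellfounded.acc ?R" if "\<not> nf x" for x
    using that by (auto intro: accI)
  ultimately show ?thesis by (meson acc_wfI)
qed

lemma cnf_mult_absorb:
  assumes "nf y" "y < OSum e OZero"
  shows "cnf_add (cnf_mult (OSum a b) y) (OSum (cnf_add a e) t) = OSum (cnf_add a e) t"
  using assms
proof (induction y)
  case (OSum c d)
  from OSum.prems have ce: "c < e" by auto
  from OSum.prems ce have "d < OSum e OZero" by (cases d) auto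
  moreover have "a < cnf_add a e"
    using cnf_add_strict_mono [of OZero e a] ce by (cases e) auto
  ultimately show ?case
    using OSum ce cnf_add_strict_mono [OF ce, of a] by (auto simp: cnf_add_assoc)
qed auto

lemma cnf_mult_add_distrib:
  assumes "nf y" "nf z"
  shows "cnf_mult x (cnf_add y z) = cnf_add (cnf_mult x y) (cnf_mult x z)"
proof (cases x)
  case OZero
  have "cnf_mult OZero w = OZero" for w by (induction w) auto
  then show ?thesis using OZero by simp
next
  case x: (OSum a b)
  show ?thesis using assms(1)
  proof (induction y)
    case (OSum c d)
    show ?case
    proof (cases z)
      case OZero then show ?thesis by simp
    next
      case z: (OSum e f)
      show ?thesis
      proof (cases "c < e")
        case True
        then have "cnf_mult x z = cnf_add (OSum (cnf_add a e) OZero) (cnf_mult x f)"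
          using x z by (auto simp: not_less_OZero)
        moreover have "cnf_add (cnf_mult x (OSum c d)) (OSum (cnf_add a e) OZero)
            = OSum (cnf_add a e) OZero"
          unfolding x by (rule cnf_mult_absorb) (use True OSum.prems in auto)
        ultimately have "cnf_add (cnf_mult x (OSum c d)) (cnf_mult x z) = cnf_mult x z"
          by (metis cnf_add_assoc)
        then show ?thesis using True z by simp
      next
        case False
        then show ?thesis using OSum z by (simp add: cnf_add_assoc)
      qed
    qed
  qed auto
qed

typedef ordE = "{x. nf x}"
  by (rule exI [of _ OZero]) simp

setup_lifting type_definition_ordE

instantiation ordE :: "{linorder, zero, one, plus, times}"
begin

lift_definition zero_ordE :: ordE is OZero by simp
lift_definition one_ordE :: ordE is "OSum OZero OZero" by simp
lift_definition plus_ordE :: "ordE \<Rightarrow> ordE \<Rightarrow> ordE" is cnf_add by (rule nf_add)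
lift_definition times_ordE :: "ordE \<Rightarrow> ordE \<Rightarrow> ordE" is cnf_mult by (rule nf_mult)
lift_definition less_ordE :: "ordE \<Rightarrow> ordE \<Rightarrow> bool" is "(<)" .
lift_definition less_eq_ordE :: "ordE \<Rightarrow> ordE \<Rightarrow> bool" is "(\<le>)" .

instance by standard (transfer; auto)+

end

lift_definition omega_pow :: "ordE \<Rightarrow> ordE" is "\<lambda>a. OSum a OZero" by simp

instance ordE :: wellorder
proof
  fix P :: "ordE \<Rightarrow> bool" and a
  assume *: "\<And>x. (\<And>y. y < x \<Longrightarrow> P y) \<Longrightarrow> P x"
  have "wf {(x::ordE, y). x < y}"
    by (rule wf_subset [OF wf_inv_image [OF wf_cnf, of Rep_ordE]])
       (use Rep_ordE in \<open>auto simp: inv_image_def less_ordE.rep_eq\<close>)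
  then show "P a" by (induction a rule: wf_induct_rule) (use * in auto)
qed

instance ordE :: monoid_add
  by standard (transfer; simp add: cnf_add_assoc)+

instance ordE :: numeral ..

lemma ordE_zero_le [simp]: "0 \<le> (a::ordE)"
  by transfer simp

lemma ordE_add_strict_mono: "b < c \<Longrightarrow> a + b < a + (c::ordE)"
  by transfer (rule cnf_add_strict_mono)

lemma ordE_le_imp_add: "a \<le> b \<Longrightarrow> \<exists>c. b = a + (c::ordE)"
  by transfer (use cnf_le_imp_add in blast)

lemma ordE_add_left_cancel: "a + b = a + c \<longleftrightarrow> b = (c::ordE)"
  by (metis less_irrefl linorder_neqE ordE_add_strict_mono)

lemma ordE_mult_zero [simp]: "a * 0 = (0::ordE)"
  by transfer simp

lemma ordE_zero_mult [simp]: "0 * a = (0::ordE)"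
proof transfer
  fix w show "cnf_mult OZero w = OZero" by (induction w) auto
qed

lemma ordE_mult_one [simp]: "a * 1 = (a::ordE)"
proof transfer
  fix w show "cnf_mult w (OSum OZero OZero) = w" by (cases w) auto
qed

lemma ordE_distrib_left: "a * (b + c) = a * b + a * (c::ordE)"
  by transfer (rule cnf_mult_add_distrib)

lemma omega_pow_zero [simp]: "omega_pow 0 = 1"
  by transfer simp

lemma omega_pow_add: "omega_pow (a + b) = omega_pow a * omega_pow b"
  by transfer auto

lemma omega_pow_strict_mono: "a < b \<Longrightarrow> omega_pow a < omega_pow b"
  by transfer simp

definition exp1 :: "ordE \<Rightarrow> ordE" where
  "exp1 \<alpha> = (THE \<delta>. 1 + \<delta> = omega_pow \<alpha>)"

definition hexp :: "nat \<Rightarrow> ordE \<Rightarrow> ordE" where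
  "hexp n = exp1 ^^ n"

lemma exp1_eq: "exp1 \<alpha> = (if \<alpha> = 0 then 0 else omega_pow \<alpha>)"
proof -
  have "1 + (if \<alpha> = 0 then 0 else omega_pow \<alpha>) = omega_pow \<alpha>"
    by transfer (auto, metis cnf.exhaust less_cnf.simps(2))
  then show ?thesis
    unfolding exp1_def by (intro the_equality) (metis ordE_add_left_cancel)+
qed

lemma hexp_add: "hexp (n + m) = hexp n \<circ> hexp m"
  by (simp add: hexp_def funpow_add)


section \<open>Formulas and monomial normal forms\<close>

datatype fm = Top | Conj fm fm (infixr "\<^bold>\<and>" 65) | Dia nat ordE fm

text \<open>
  The modality with exponent \<open>0\<close> is not a separate formula: prefixing it to \<open>\<phi>\<close>
  yields \<open>\<phi>\<close> itself. Hence \<open>dia\<close> is used throughout in place of the constructor, and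
  the formulas of the language are those in \<open>Fm\<close>.
\<close>

definition dia :: "nat \<Rightarrow> ordE \<Rightarrow> fm \<Rightarrow> fm" where
  "dia n \<alpha> \<phi> = (if \<alpha> = 0 then \<phi> else Dia n \<alpha> \<phi>)"

inductive_set Fm :: "fm set" where
  "Top \<in> Fm"
| "\<phi> \<in> Fm \<Longrightarrow> \<psi> \<in> Fm \<Longrightarrow> \<phi> \<^bold>\<and> \<psi> \<in> Fm"
| "\<phi> \<in> Fm \<Longrightarrow> dia n \<alpha> \<phi> \<in> Fm"

text \<open>\<open>mconj (n\<^sub>0, \<alpha>\<^sub>0) [(n\<^sub>1, \<alpha>\<^sub>1), \<dots>]\<close> is the conjunction of the listed monomials.\<close>

fun mconj :: "nat \<times> ordE \<Rightarrow> (nat \<times> ordE) list \<Rightarrow> fm" where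
  "mconj (n, \<alpha>) [] = dia n \<alpha> Top"
| "mconj (n, \<alpha>) (m # ms) = dia n \<alpha> Top \<^bold>\<and> mconj m ms"

inductive_set MNF :: "fm set" where
  top: "Top \<in> MNF"
| monomial: "dia n \<alpha> Top \<in> MNF"
| conj: "mconj (n\<^sub>0, \<alpha>\<^sub>0) ms \<in> MNF \<Longrightarrow> n < n\<^sub>0 \<Longrightarrow> \<alpha> = hexp (n\<^sub>0 - n) \<alpha>\<^sub>0 * (2 + \<beta>) \<Longrightarrow>
    dia n \<alpha> Top \<^bold>\<and> mconj (n\<^sub>0, \<alpha>\<^sub>0) ms \<in> MNF"


section \<open>The calculus\<close>

text \<open>
  The Schmerl axioms require \<open>\<alpha>\<^sub>0 > 0\<close>, i.e. that the leading conjunct is a genuine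
  modality: as \<open>\<langle>n\<^sub>0\<^sup>0\<rangle>\<top>\<close> is \<open>\<top>\<close> and \<open>hexp k 0 = 0\<close>, the instance with \<open>\<alpha>\<^sub>0 = 0\<close> would read
  \<open>\<langle>n\<^sup>\<alpha>\<rangle>\<top> \<equiv> \<top>\<close> and collapse the calculus.
\<close>

inductive tsc :: "fm \<Rightarrow> fm \<Rightarrow> bool" (infix "\<turnstile>" 50) where
  refl: "\<phi> \<in> Fm \<Longrightarrow> \<phi> \<turnstile> \<phi>"
| top: "\<phi> \<in> Fm \<Longrightarrow> \<phi> \<turnstile> Top"
| conjL: "\<phi> \<in> Fm \<Longrightarrow> \<psi> \<in> Fm \<Longrightarrow> \<phi> \<^bold>\<and> \<psi> \<turnstile> \<phi>"
| conjR: "\<phi> \<in> Fm \<Longrightarrow> \<psi> \<in> Fm \<Longrightarrow> \<phi> \<^bold>\<and> \<psi> \<turnstile> \<psi>"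
| mono: "\<phi> \<in> Fm \<Longrightarrow> \<beta> \<le> \<alpha> \<Longrightarrow> dia n \<alpha> \<phi> \<turnstile> dia n \<beta> \<phi>"
| coadd1: "\<phi> \<in> Fm \<Longrightarrow> dia n (\<alpha> + \<beta>) \<phi> \<turnstile> dia n \<beta> (dia n \<alpha> \<phi>)"
| coadd2: "\<phi> \<in> Fm \<Longrightarrow> dia n \<beta> (dia n \<alpha> \<phi>) \<turnstile> dia n (\<alpha> + \<beta>) \<phi>"
| reduce: "\<phi> \<in> Fm \<Longrightarrow> dia (m + n) \<alpha> \<phi> \<turnstile> dia m (hexp n \<alpha>) \<phi>"
| schmerl1: "mconj (n\<^sub>0, \<alpha>\<^sub>0) ms \<in> MNF \<Longrightarrow> 0 < \<alpha>\<^sub>0 \<Longrightarrow> n < n\<^sub>0 \<Longrightarrow>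
    dia n \<alpha> (mconj (n\<^sub>0, \<alpha>\<^sub>0) ms) \<turnstile>
    dia n (hexp (n\<^sub>0 - n) \<alpha>\<^sub>0 * (1 + \<alpha>)) Top \<^bold>\<and> mconj (n\<^sub>0, \<alpha>\<^sub>0) ms"
| schmerl2: "mconj (n\<^sub>0, \<alpha>\<^sub>0) ms \<in> MNF \<Longrightarrow> 0 < \<alpha>\<^sub>0 \<Longrightarrow> n < n\<^sub>0 \<Longrightarrow>
    dia n (hexp (n\<^sub>0 - n) \<alpha>\<^sub>0 * (1 + \<alpha>)) Top \<^bold>\<and> mconj (n\<^sub>0, \<alpha>\<^sub>0) ms \<turnstile>
    dia n \<alpha> (mconj (n\<^sub>0, \<alpha>\<^sub>0) ms)"
| conjI: "\<phi> \<turnstile> \<psi> \<Longrightarrow> \<phi> \<turnstile> \<chi> \<Longrightarrow> \<phi> \<turnstile> \<psi> \<^bold>\<and> \<chi>"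
| cut: "\<phi> \<turnstile> \<psi> \<Longrightarrow> \<psi> \<turnstile> \<chi> \<Longrightarrow> \<phi> \<turnstile> \<chi>"
| nec: "\<phi> \<turnstile> \<psi> \<Longrightarrow> dia n \<alpha> \<phi> \<turnstile> dia n \<alpha> \<psi>"
| conj_in: "\<phi> \<turnstile> \<psi> \<Longrightarrow> m < n \<Longrightarrow>
    dia n \<alpha> \<phi> \<^bold>\<and> dia m (\<beta> + 1) \<psi> \<turnstile> dia n \<alpha> (\<phi> \<^bold>\<and> dia m (\<beta> + 1) \<psi>)"

definition tsc_equiv :: "fm \<Rightarrow> fm \<Rightarrow> bool" (infix "\<equiv>\<^sub>T" 50) where
  "\<phi> \<equiv>\<^sub>T \<psi> \<longleftrightarrow> \<phi> \<turnstile> \<psi> \<and> \<psi> \<turnstile> \<phi>"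

lemma MNF_subset_Fm: "MNF \<subseteq> Fm"
proof
  fix \<phi> assume "\<phi> \<in> MNF"
  then show "\<phi> \<in> Fm" by induction (auto intro: Fm.intros)
qed

lemma tsc_Fm: "\<phi> \<turnstile> \<psi> \<Longrightarrow> \<phi> \<in> Fm \<and> \<psi> \<in> Fm"
  by (induction rule: tsc.induct) (use MNF_subset_Fm in \<open>auto intro!: Fm.intros\<close>)

end

theory Submission
  imports Defs
begin

text \<open>
  Let \<open>\<psi>\<close> be a normal form with leading monomial \<open>\<langle>n\<^sub>0\<^bsup>\<alpha>\<^sub>0\<^esup>\<rangle>\<top>\<close> and rest \<open>\<chi>\<close>, and let \<open>\<alpha> > 0\<close>.
  If \<open>n < n\<^sub>0\<close>, a Schmerl axiom gives the claim directly. If \<open>n = n\<^sub>0\<close>, the Schmerl axiom turns \<open>\<psi>\<close>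
  into some \<open>\<langle>n\<^sup>\<delta>\<rangle>\<chi>\<close>, the two modalities add up, and the Schmerl axiom is applied backwards. If
  \<open>n > n\<^sub>0\<close>, then \<open>\<langle>n\<^sup>\<alpha>\<rangle>\<psi>\<close> already implies \<open>\<langle>n\<^sub>0\<^sup>1\<rangle>\<langle>n\<^sub>0\<^bsup>\<alpha>\<^sub>0\<^esup>\<rangle>\<top>\<close>, so that \<open>\<alpha>\<^sub>0\<close> may be replaced by its
  successor and the monomial be pulled out: \<open>\<langle>n\<^sup>\<alpha>\<rangle>\<psi>\<close> is equivalent to the conjunction of
  \<open>\<langle>n\<^sub>0\<^bsup>\<alpha>\<^sub>0 + 1\<^esup>\<rangle>\<top>\<close> and \<open>\<langle>n\<^sup>\<alpha>\<rangle>\<chi>\<close>. The latter has a normal form by induction, with a leading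
  monomial \<open>\<langle>m\<^sup>\<mu>\<rangle>\<top>\<close> where \<open>m > n\<^sub>0\<close>. In the presence of \<open>\<langle>m\<^sup>\<mu>\<rangle>\<top>\<close>, exponents of \<open>n\<^sub>0\<close> may be rounded up
  to a multiple of \<open>\<epsilon> = e\<^bsup>m - n\<^sub>0\<^esup>(\<mu>)\<close>, because \<open>\<langle>m\<^sup>\<mu>\<rangle>\<close> absorbs \<open>\<langle>n\<^sub>0\<^bsup>\<epsilon>\<xi> + 1\<^esup>\<rangle>\<top>\<close> and then
  reduces to \<open>\<langle>n\<^sub>0\<^sup>\<epsilon>\<rangle>\<close>. The multiples by \<open>0\<close> and \<open>1\<close> are implied by \<open>\<langle>m\<^sup>\<mu>\<rangle>\<top>\<close>, and all others are
  allowed in a normal form.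
\<close>

section \<open>Ordinal arithmetic and division by powers of omega\<close>

lemma ordE_pos_iff: "0 < (a::ordE) \<longleftrightarrow> a \<noteq> 0"
  using ordE_zero_le[of a] by (auto simp: order_less_le)

lemma ordE_add_left_mono: "b \<le> c \<Longrightarrow> a + b \<le> a + (c::ordE)"
  by (auto simp: order_le_less ordE_add_strict_mono)

lemma ordE_le_add_right: "a \<le> a + (b::ordE)"
  using ordE_add_left_mono[of 0 b a] by simp

text \<open>Descent: if \<open>a + b < b\<close>, then \<open>a + b\<close> is a smaller
  counterexample.\<close>

lemma ordE_le_add_left: "b \<le> a + (b::ordE)"
proof (rule ccontr)
  assume "\<not> b \<le> a + b"
  then have "a + b < b" by simp
  then show False
  proof (induction b rule: less_induct)
    case (less b)
    then show ?case using ordE_add_strict_mono[of "a + b" b a] by blast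
  qed
qed

lemma ordE_add_pos_left: "0 < a \<Longrightarrow> 0 < a + (b::ordE)"
  using ordE_le_add_right less_le_trans by blast

lemma ordE_one_pos [simp]: "0 < (1::ordE)"
  by transfer simp

lemma ordE_one_le:
  assumes "0 < (a::ordE)"
  shows "1 \<le> a"
proof (rule ccontr)
  assume "\<not> 1 \<le> a"
  then have "a < 1" by simp
  then have "a = 0"
  proof transfer
    fix a assume "a < OSum OZero OZero"
    then show "a = OZero" by (cases a) auto
  qed
  with assms show False by simp
qed

lemma ordE_pos_cases:
  assumes "0 < (a::ordE)"
  obtains b where "a = 1 + b"
  using ordE_le_imp_add[OF ordE_one_le[OF assms]] by blast

lemma ordE_mult_pos: "0 < a \<Longrightarrow> 0 < b \<Longrightarrow> 0 < a * (b::ordE)"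
  by (elim ordE_pos_cases[of b]) (simp add: ordE_distrib_left ordE_add_pos_left)

lemma omega_pow_pos: "0 < omega_pow a"
  by transfer simp

text \<open>\<open>omega_pow a\<close> is the leading Cantor term of \<gamma>; the last conjunct
  records that its exponent is maximal.\<close>

lemma ordE_omega_pow_decomp:
  assumes "0 < (\<gamma>::ordE)"
  shows "\<exists>a b. \<gamma> = omega_pow a + b \<and> b < \<gamma> \<and> (\<forall>c. a < c \<longrightarrow> \<gamma> < omega_pow c)"
  using assms
proof transfer
  fix \<gamma> :: cnf assume *: "nf \<gamma>" "OZero < \<gamma>"
  then obtain a b where ab: "\<gamma> = OSum a b" by (cases \<gamma>) auto
  have less: "nf (OSum a b) \<Longrightarrow> b < OSum a b" for a b
    by (induction b arbitrary: a) (auto simp: less_eq_cnf_def)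
  have "cnf_add (OSum a OZero) b = OSum a b"
    using * ab by (cases b) auto
  then show "\<exists>a\<in>Collect nf. \<exists>b\<in>Collect nf. \<gamma> = cnf_add (OSum a OZero) b \<and> b < \<gamma> \<and>
      (\<forall>c\<in>Collect nf. a < c \<longrightarrow> \<gamma> < OSum c OZero)"
    using * ab less by (intro bexI[of _ a] bexI[of _ b]) auto
qed

text \<open>A leading exponent \<open>a = c + d\<close> contributes the multiple
  \<open>omega_pow c * omega_pow d\<close>; peeling off such terms leaves the remainder.\<close>

lemma ordE_division_omega_pow:
  obtains \<xi> \<rho> where "\<gamma> = omega_pow c * \<xi> + \<rho>" "\<rho> < omega_pow c"
proof -
  have "\<exists>\<xi> \<rho>. \<gamma> = omega_pow c * \<xi> + \<rho> \<and> \<rho> < omega_pow c"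
  proof (induction \<gamma> rule: less_induct)
    case (less \<gamma>)
    show ?case
    proof (cases "\<gamma> < omega_pow c")
      case True
      then show ?thesis by (intro exI[of _ 0] exI[of _ \<gamma>]) simp
    next
      case False
      then have "0 < \<gamma>" using omega_pow_pos less_le_trans not_less by blast
      then obtain a b where ab: "\<gamma> = omega_pow a + b" "b < \<gamma>" "\<forall>c. a < c \<longrightarrow> \<gamma> < omega_pow c"
        using ordE_omega_pow_decomp by blast
      with False have "c \<le> a" by (auto simp: not_less[symmetric])
      then obtain d where d: "a = c + d" using ordE_le_imp_add by blast
      obtain \<xi> \<rho> where "b = omega_pow c * \<xi> + \<rho>" "\<rho> < omega_pow c"
        using less ab by blast
      then have "\<gamma> = omega_pow c * (omega_pow d + \<xi>) + \<rho>"
        using ab(1) d by (simp add: omega_pow_add ordE_distrib_left add.assoc)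
      with \<open>\<rho> < omega_pow c\<close> show ?thesis by blast
    qed
  qed
  then show thesis using that by blast
qed

section \<open>Hyper-exponentials\<close>

lemma hexp_pos: "0 < \<alpha> \<Longrightarrow> 0 < hexp k \<alpha>"
  by (induction k) (auto simp: hexp_def exp1_eq omega_pow_pos)

text \<open>Makes division by a hyper-exponential an instance of division by a power of
  omega.\<close>

lemma hexp_omega_pow:
  assumes "0 < \<alpha>" "0 < k"
  obtains c where "hexp k \<alpha> = omega_pow c"
proof (cases k)
  case (Suc j)
  have "hexp k \<alpha> = exp1 (hexp j \<alpha>)" by (simp add: Suc hexp_def)
  also have "\<dots> = omega_pow (hexp j \<alpha>)"
    using hexp_pos[OF assms(1), of j] by (simp add: exp1_eq ordE_pos_iff)
  finally show thesis by (rule that)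
qed (use assms in simp)

lemma hexp_0_right: "hexp k 0 = 0"
  by (induction k) (auto simp: hexp_def exp1_eq)

lemma ordE_two_add: "2 + \<beta> = 1 + (1 + \<beta>)" for \<beta> :: ordE
  by (simp add: add.assoc[symmetric] one_add_one)

section \<open>Derived rules of the calculus\<close>

lemma dia_0 [simp]: "dia n 0 \<phi> = \<phi>"
  by (simp add: dia_def)

declare tsc.cut [trans]

lemma tsc_equiv_refl: "\<phi> \<in> Fm \<Longrightarrow> \<phi> \<equiv>\<^sub>T \<phi>"
  by (simp add: tsc_equiv_def tsc.refl)

lemma tsc_equiv_sym: "\<phi> \<equiv>\<^sub>T \<psi> \<Longrightarrow> \<psi> \<equiv>\<^sub>T \<phi>"
  by (simp add: tsc_equiv_def)

lemma tsc_equiv_trans [trans]: "\<phi> \<equiv>\<^sub>T \<psi> \<Longrightarrow> \<psi> \<equiv>\<^sub>T \<chi> \<Longrightarrow> \<phi> \<equiv>\<^sub>T \<chi>"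
  by (auto simp: tsc_equiv_def intro: tsc.cut)

lemma tsc_equiv_dia: "\<phi> \<equiv>\<^sub>T \<psi> \<Longrightarrow> dia n \<alpha> \<phi> \<equiv>\<^sub>T dia n \<alpha> \<psi>"
  by (simp add: tsc_equiv_def tsc.nec)

lemma tsc_conj_mono: "\<phi> \<turnstile> \<phi>' \<Longrightarrow> \<psi> \<turnstile> \<psi>' \<Longrightarrow> \<phi> \<^bold>\<and> \<psi> \<turnstile> \<phi>' \<^bold>\<and> \<psi>'"
  by (meson tsc.conjI tsc.conjL tsc.conjR tsc.cut tsc_Fm)

lemma tsc_equiv_conj: "\<phi> \<equiv>\<^sub>T \<phi>' \<Longrightarrow> \<psi> \<equiv>\<^sub>T \<psi>' \<Longrightarrow> \<phi> \<^bold>\<and> \<psi> \<equiv>\<^sub>T \<phi>' \<^bold>\<and> \<psi>'"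
  by (simp add: tsc_equiv_def tsc_conj_mono)

lemma tsc_equiv_coadd: "\<phi> \<in> Fm \<Longrightarrow> dia n \<beta> (dia n \<alpha> \<phi>) \<equiv>\<^sub>T dia n (\<alpha> + \<beta>) \<phi>"
  by (simp add: tsc_equiv_def tsc.coadd1 tsc.coadd2)

lemma tsc_equiv_conj_Top: "\<phi> \<in> Fm \<Longrightarrow> \<phi> \<equiv>\<^sub>T \<phi> \<^bold>\<and> Top"
  by (simp add: tsc_equiv_def Fm.intros tsc.intros)

lemma tsc_equiv_conj_absorb: "\<psi> \<turnstile> \<phi> \<Longrightarrow> \<phi> \<^bold>\<and> \<psi> \<equiv>\<^sub>T \<psi>"
  unfolding tsc_equiv_def by (meson tsc.conjI tsc.conjR tsc.refl tsc_Fm)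

section \<open>Normal forms with a genuine leading modality\<close>

text \<open>
  In \<open>MNF\<close> all exponents may be \<open>0\<close>, which yields conjunctions of \<open>\<top>\<close>. The predicate \<open>mnf_lead n \<alpha>\<close>
  describes the remaining normal forms, whose leading monomial \<open>\<langle>n\<^sup>\<alpha>\<rangle>\<top>\<close> is then determined.
\<close>

inductive mnf_lead :: "nat \<Rightarrow> ordE \<Rightarrow> fm \<Rightarrow> bool" where
  base: "0 < \<alpha> \<Longrightarrow> mnf_lead n \<alpha> (dia n \<alpha> Top)"
| step: "mnf_lead n\<^sub>0 \<alpha>\<^sub>0 \<phi> \<Longrightarrow> n < n\<^sub>0 \<Longrightarrow> \<alpha> = hexp (n\<^sub>0 - n) \<alpha>\<^sub>0 * (2 + \<beta>) \<Longrightarrow>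
    mnf_lead n \<alpha> (dia n \<alpha> Top \<^bold>\<and> \<phi>)"

lemma mnf_lead_pos: "mnf_lead n \<alpha> \<phi> \<Longrightarrow> 0 < \<alpha>"
  by (induction rule: mnf_lead.induct)
    (auto simp: ordE_two_add intro!: ordE_mult_pos hexp_pos ordE_add_pos_left)

lemma mnf_lead_mconj:
  assumes "mnf_lead n \<alpha> \<phi>"
  obtains ms where "\<phi> = mconj (n, \<alpha>) ms" "mconj (n, \<alpha>) ms \<in> MNF"
proof -
  have "\<exists>ms. \<phi> = mconj (n, \<alpha>) ms \<and> \<phi> \<in> MNF"
    using assms
  proof (induction rule: mnf_lead.induct)
    case (base \<alpha> n)
    then show ?case by (intro exI[of _ "[]"]) (simp add: MNF.monomial)
  next
    case (step n\<^sub>0 \<alpha>\<^sub>0 \<phi> n \<alpha> \<beta>)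
    then obtain ms where "\<phi> = mconj (n\<^sub>0, \<alpha>\<^sub>0) ms" "\<phi> \<in> MNF" by blast
    with step show ?case
      by (intro exI[of _ "(n\<^sub>0, \<alpha>\<^sub>0) # ms"]) (auto intro: MNF.conj)
  qed
  then show thesis using that by blast
qed

lemma mnf_lead_MNF: "mnf_lead n \<alpha> \<phi> \<Longrightarrow> \<phi> \<in> MNF"
  by (elim mnf_lead_mconj) simp

lemma mnf_lead_Fm: "mnf_lead n \<alpha> \<phi> \<Longrightarrow> \<phi> \<in> Fm"
  using mnf_lead_MNF MNF_subset_Fm by blast

lemma dia_Top_Fm: "dia n \<alpha> Top \<in> Fm"
  by (simp add: Fm.intros)

text \<open>Positivity excludes \<open>dia m 0 Top\<close>, where \<open>m\<close> would be
  arbitrary.\<close>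

lemma mnf_lead_unique:
  assumes "mnf_lead n \<alpha> (mconj (m, \<mu>) ms)"
  shows "m = n \<and> \<mu> = \<alpha>"
  using assms mnf_lead_pos[OF assms]
  by (cases rule: mnf_lead.cases; cases ms) (auto simp: dia_def split: if_splits)

text \<open>The clause on \<open>mconj\<close> strengthens the induction: a monomial put in front of
  a trivial conjunction gets exponent 0 as well, because \<open>hexp k 0 = 0\<close>.\<close>

lemma MNF_cases_lead:
  assumes "\<phi> \<in> MNF"
  shows "(\<phi> \<equiv>\<^sub>T Top \<and> (\<forall>n \<alpha> ms. \<phi> = mconj (n, \<alpha>) ms \<longrightarrow> \<alpha> = 0)) \<or> (\<exists>n \<alpha>. mnf_lead n \<alpha> \<phi>)"
  using assms
proof (induction rule: MNF.induct)
  case top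
  have "\<alpha> = 0" if "Top = mconj (n, \<alpha>) ms" for n \<alpha> ms
    using that by (cases ms) (auto simp: dia_def split: if_splits)
  then show ?case by (auto intro: tsc_equiv_refl Fm.intros)
next
  case (monomial n \<alpha>)
  show ?case
  proof (cases "\<alpha> = 0")
    case True
    have "\<alpha> = 0" if "Top = mconj (n, \<alpha>) ms" for n \<alpha> ms
      using that by (cases ms) (auto simp: dia_def split: if_splits)
    with True show ?thesis by (auto intro: tsc_equiv_refl Fm.intros)
  next
    case False
    then show ?thesis using mnf_lead.base[of \<alpha> n] by (auto simp: ordE_pos_iff)
  qed
next
  case (conj n\<^sub>0 \<alpha>\<^sub>0 ms n \<alpha> \<beta>)
  from conj.IH show ?case
  proof (elim disjE exE conjE)
    assume *: "mconj (n\<^sub>0, \<alpha>\<^sub>0) ms \<equiv>\<^sub>T Top"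
      and "\<forall>n \<alpha> ms'. mconj (n\<^sub>0, \<alpha>\<^sub>0) ms = mconj (n, \<alpha>) ms' \<longrightarrow> \<alpha> = 0"
    then have "\<alpha>\<^sub>0 = 0" by blast
    then have [simp]: "\<alpha> = 0" by (simp add: conj.hyps hexp_0_right)
    have "\<mu> = 0" if "Top \<^bold>\<and> mconj (n\<^sub>0, \<alpha>\<^sub>0) ms = mconj (m, \<mu>) ms'" for m \<mu> ms'
      using that by (cases ms') (auto simp: dia_def split: if_splits)
    moreover have "Top \<^bold>\<and> mconj (n\<^sub>0, \<alpha>\<^sub>0) ms \<equiv>\<^sub>T Top"
      using tsc_equiv_conj_absorb * tsc_equiv_trans unfolding tsc_equiv_def
      by (meson tsc.cut)
    ultimately show ?thesis by auto
  next
    fix n\<^sub>1 \<alpha>\<^sub>1 assume "mnf_lead n\<^sub>1 \<alpha>\<^sub>1 (mconj (n\<^sub>0, \<alpha>\<^sub>0) ms)"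
    with mnf_lead_unique have "mnf_lead n\<^sub>0 \<alpha>\<^sub>0 (mconj (n\<^sub>0, \<alpha>\<^sub>0) ms)" by blast
    then show ?thesis using conj.hyps mnf_lead.step by blast
  qed
qed

section \<open>Prefixing a modality to a normal form\<close>

lemma schmerl_equiv:
  assumes "mnf_lead n\<^sub>0 \<alpha>\<^sub>0 \<phi>" "n < n\<^sub>0"
  shows "dia n \<alpha> \<phi> \<equiv>\<^sub>T dia n (hexp (n\<^sub>0 - n) \<alpha>\<^sub>0 * (1 + \<alpha>)) Top \<^bold>\<and> \<phi>"
  using assms mnf_lead_pos[OF assms(1)]
  by (elim mnf_lead_mconj) (simp add: tsc_equiv_def tsc.schmerl1 tsc.schmerl2)

lemma dia_below_lead:
  assumes "mnf_lead n\<^sub>0 \<alpha>\<^sub>0 \<phi>" "n < n\<^sub>0" "0 < \<alpha>"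
  obtains \<mu> \<phi>' where "mnf_lead n \<mu> \<phi>'" "dia n \<alpha> \<phi> \<equiv>\<^sub>T \<phi>'"
proof -
  obtain \<beta> where "\<alpha> = 1 + \<beta>" using ordE_pos_cases[OF assms(3)] .
  \<comment> \<open>Positivity of \<alpha> turns the Schmerl factor into the one that normal forms
    demand.\<close>
  then have "1 + \<alpha> = 2 + \<beta>" by (simp add: ordE_two_add)
  with assms schmerl_equiv mnf_lead.step show thesis by (metis that)
qed

lemma mnf_lead_tsc: "mnf_lead n \<alpha> \<phi> \<Longrightarrow> \<phi> \<turnstile> dia n \<alpha> Top"
  by (erule mnf_lead.cases) (auto intro: tsc.refl tsc.conjL dia_Top_Fm mnf_lead_Fm)

lemma monomial_round_up:
  assumes "n < m"
  shows "dia n (\<gamma> + 1) Top \<^bold>\<and> dia m \<mu> Top \<turnstile> dia n (\<gamma> + hexp (m - n) \<mu>) Top"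
proof -
  let ?\<epsilon> = "hexp (m - n) \<mu>" and ?X = "dia n (\<gamma> + 1) Top"
  note fm = dia_Top_Fm Fm.intros
  have "?X \<^bold>\<and> dia m \<mu> Top \<turnstile> dia m \<mu> Top \<^bold>\<and> ?X"
    by (intro tsc.conjI tsc.conjL tsc.conjR fm)
  also have "\<dots> \<turnstile> dia m \<mu> (Top \<^bold>\<and> ?X)"
    by (intro tsc.conj_in tsc.refl fm assms)
  also have "\<dots> \<turnstile> dia m \<mu> ?X"
    by (intro tsc.nec tsc.conjR fm)
  also have "\<dots> \<turnstile> dia n ?\<epsilon> ?X"
    using tsc.reduce[of ?X n "m - n" \<mu>] assms by (simp add: dia_Top_Fm)
  also have "\<dots> \<turnstile> dia n (\<gamma> + 1 + ?\<epsilon>) Top"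
    by (intro tsc.coadd2 fm)
  also have "\<dots> \<turnstile> dia n (\<gamma> + ?\<epsilon>) Top"
    by (intro tsc.mono fm) (simp add: add.assoc ordE_add_left_mono ordE_le_add_left)
  finally show ?thesis .
qed

text \<open>If \<gamma> is at most \<epsilon>, the monomial is absorbed; otherwise it is kept when
  \<epsilon> divides \<gamma>, and rounded up to the next multiple when not.\<close>

lemma monomial_conj_lead:
  assumes "mnf_lead m \<mu> \<phi>" "n < m"
  obtains m' \<mu>' \<phi>' where "mnf_lead m' \<mu>' \<phi>'" "n \<le> m'" "dia n \<gamma> Top \<^bold>\<and> \<phi> \<equiv>\<^sub>T \<phi>'"
proof -
  let ?\<epsilon> = "hexp (m - n) \<mu>"
  note fm = dia_Top_Fm Fm.intros mnf_lead_Fm[OF assms(1)]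
  have lead: "\<phi> \<turnstile> dia m \<mu> Top" using mnf_lead_tsc[OF assms(1)] .
  show thesis
  proof (cases "\<gamma> \<le> ?\<epsilon>")
    case True
    have "dia m \<mu> Top \<turnstile> dia n ?\<epsilon> Top"
      using tsc.reduce[of Top n "m - n" \<mu>] assms(2) by (simp add: fm)
    then have "\<phi> \<turnstile> dia n \<gamma> Top"
      using tsc.mono[OF Fm.intros(1) True] lead tsc.cut by blast
    then show thesis using that[OF assms(1)] assms(2) tsc_equiv_conj_absorb by auto
  next
    case False
    obtain c where c: "?\<epsilon> = omega_pow c"
      using hexp_omega_pow[OF mnf_lead_pos[OF assms(1)], of "m - n"] assms(2) by auto
    obtain \<xi> \<rho> where \<gamma>: "\<gamma> = ?\<epsilon> * \<xi> + \<rho>" "\<rho> < ?\<epsilon>"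
      unfolding c by (rule ordE_division_omega_pow)
    with False have "\<xi> \<noteq> 0" by auto
    then obtain \<xi>' where \<xi>': "\<xi> = 1 + \<xi>'" by (auto simp: ordE_pos_iff[symmetric] elim: ordE_pos_cases)
    show thesis
    proof (cases "\<rho> = 0")
      case True
      \<comment> \<open>Quotient 1 would mean \<gamma> = \<epsilon>, so the quotient is at least
        2.\<close>
      with \<gamma> \<xi>' False have "0 < \<xi>'" by (auto simp: ordE_pos_iff)
      then obtain \<beta> where "\<xi>' = 1 + \<beta>" by (rule ordE_pos_cases)
      with True \<gamma> \<xi>' have "\<gamma> = ?\<epsilon> * (2 + \<beta>)" by (simp add: ordE_two_add)
      then have "mnf_lead n \<gamma> (dia n \<gamma> Top \<^bold>\<and> \<phi>)" using assms mnf_lead.step by blast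
      then show thesis using that[OF _ order.refl] tsc_equiv_refl mnf_lead_Fm by blast
    next
      case False
      let ?\<delta> = "?\<epsilon> * (\<xi> + 1)"
      have \<delta>: "?\<delta> = ?\<epsilon> * \<xi> + ?\<epsilon>" by (simp add: ordE_distrib_left)
      have "?\<epsilon> * \<xi> + 1 \<le> \<gamma>" using False \<gamma>
        by (simp add: ordE_add_left_mono ordE_one_le ordE_pos_iff)
      then have "dia n \<gamma> Top \<^bold>\<and> \<phi> \<turnstile> dia n (?\<epsilon> * \<xi> + 1) Top \<^bold>\<and> dia m \<mu> Top"
        by (intro tsc_conj_mono tsc.mono lead fm)
      then have "dia n \<gamma> Top \<^bold>\<and> \<phi> \<turnstile> dia n ?\<delta> Top"
        unfolding \<delta> using monomial_round_up[OF assms(2)] tsc.cut by blast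
      then have "dia n \<gamma> Top \<^bold>\<and> \<phi> \<turnstile> dia n ?\<delta> Top \<^bold>\<and> \<phi>"
        by (intro tsc.conjI tsc.conjR fm)
      moreover have "\<gamma> \<le> ?\<delta>" unfolding \<delta> using \<gamma> by (simp add: ordE_add_left_mono)
      then have "dia n ?\<delta> Top \<^bold>\<and> \<phi> \<turnstile> dia n \<gamma> Top \<^bold>\<and> \<phi>"
        by (intro tsc_conj_mono tsc.mono tsc.refl fm)
      ultimately have equiv: "dia n \<gamma> Top \<^bold>\<and> \<phi> \<equiv>\<^sub>T dia n ?\<delta> Top \<^bold>\<and> \<phi>"
        by (simp add: tsc_equiv_def)
      \<comment> \<open>Addition does not commute: to write \<open>1 + \<xi>' + 1\<close> as
        \<open>2 + \<beta>\<close>, a 1 is split off \<open>\<xi>' + 1\<close> on the left.\<close>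
      have "0 < \<xi>' + 1" using ordE_le_add_left[of 1 \<xi>'] ordE_one_pos less_le_trans by blast
      then obtain \<beta> where "\<xi>' + 1 = 1 + \<beta>" by (rule ordE_pos_cases)
      then have "?\<delta> = ?\<epsilon> * (2 + \<beta>)" by (simp add: \<xi>' ordE_two_add add.assoc)
      then have "mnf_lead n ?\<delta> (dia n ?\<delta> Top \<^bold>\<and> \<phi>)" using assms mnf_lead.step by blast
      then show thesis using that[OF _ order.refl equiv] by blast
    qed
  qed
qed

text \<open>The successor serves both directions: the outer modality reduces to
  \<open>dia k 1\<close>, which adds 1 to \<gamma>, and \<open>conj_in\<close> needs a successor
  exponent to move the monomial inside.\<close>

lemma dia_above_monomial:
  assumes "\<chi> \<in> Fm" "k < n" "0 < \<alpha>"
  shows "dia n \<alpha> (dia k \<gamma> Top \<^bold>\<and> \<chi>) \<equiv>\<^sub>T dia k (\<gamma> + 1) Top \<^bold>\<and> dia n \<alpha> \<chi>"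
proof -
  let ?\<phi> = "dia k \<gamma> Top" and ?\<phi>' = "dia k (\<gamma> + 1) Top"
  note fm = dia_Top_Fm Fm.intros assms(1)
  have "dia n \<alpha> (?\<phi> \<^bold>\<and> \<chi>) \<turnstile> dia n \<alpha> ?\<phi>"
    by (intro tsc.nec tsc.conjL fm)
  also have "\<dots> \<turnstile> dia k (hexp (n - k) \<alpha>) ?\<phi>"
    using tsc.reduce[of ?\<phi> k "n - k" \<alpha>] assms by (simp add: fm)
  also have "\<dots> \<turnstile> dia k 1 ?\<phi>"
    by (intro tsc.mono fm ordE_one_le hexp_pos assms)
  also have "\<dots> \<turnstile> ?\<phi>'"
    by (intro tsc.coadd2 fm)
  finally have "dia n \<alpha> (?\<phi> \<^bold>\<and> \<chi>) \<turnstile> ?\<phi>' \<^bold>\<and> dia n \<alpha> \<chi>"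
    by (intro tsc.conjI tsc.nec tsc.conjR fm)
  moreover have "?\<phi>' \<^bold>\<and> dia n \<alpha> \<chi> \<turnstile> dia n \<alpha> \<chi> \<^bold>\<and> ?\<phi>'"
    by (intro tsc.conjI tsc.conjL tsc.conjR fm)
  moreover have "dia n \<alpha> \<chi> \<^bold>\<and> ?\<phi>' \<turnstile> dia n \<alpha> (\<chi> \<^bold>\<and> ?\<phi>')"
    by (intro tsc.conj_in tsc.top fm assms)
  moreover have "?\<phi>' \<turnstile> ?\<phi>"
    by (intro tsc.mono fm ordE_le_add_right)
  then have "dia n \<alpha> (\<chi> \<^bold>\<and> ?\<phi>') \<turnstile> dia n \<alpha> (?\<phi> \<^bold>\<and> \<chi>)"
    by (meson tsc.nec tsc.conjI tsc.conjL tsc.conjR tsc.cut fm)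
  ultimately show ?thesis
    unfolding tsc_equiv_def by (meson tsc.cut)
qed

text \<open>The bound on \<open>m\<close> is for the induction: if \<open>n\<^sub>0 < n\<close>, it
  puts the leading index obtained for the rest above \<open>n\<^sub>0\<close>, as
  \<open>monomial_conj_lead\<close> requires.\<close>

lemma dia_mnf_lead:
  assumes "mnf_lead n\<^sub>0 \<alpha>\<^sub>0 \<phi>" "0 < \<alpha>"
  shows "\<exists>m \<mu> \<phi>'. mnf_lead m \<mu> \<phi>' \<and> min n n\<^sub>0 \<le> m \<and> dia n \<alpha> \<phi> \<equiv>\<^sub>T \<phi>'"
  using assms
proof (induction rule: mnf_lead.induct)
  case (base \<alpha>\<^sub>0 n\<^sub>0)
  note lead = mnf_lead.base[OF base.hyps, of n\<^sub>0]
  consider "n < n\<^sub>0" | "n = n\<^sub>0" | "n\<^sub>0 < n" by linarith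
  then show ?case
  proof cases
    case 1
    then obtain \<mu> \<phi>' where "mnf_lead n \<mu> \<phi>'" "dia n \<alpha> (dia n\<^sub>0 \<alpha>\<^sub>0 Top) \<equiv>\<^sub>T \<phi>'"
      using dia_below_lead[OF lead _ base.prems] by blast
    then show ?thesis by (meson min.cobounded1)
  next
    case 2
    have "mnf_lead n (\<alpha>\<^sub>0 + \<alpha>) (dia n (\<alpha>\<^sub>0 + \<alpha>) Top)"
      by (intro mnf_lead.base ordE_add_pos_left base.hyps)
    then show ?thesis
      using tsc_equiv_coadd[OF Fm.intros(1), of n \<alpha> \<alpha>\<^sub>0] 2 by (meson min.cobounded1)
  next
    case 3
    obtain m \<mu> \<phi>' where *: "mnf_lead m \<mu> \<phi>'" "n\<^sub>0 \<le> m"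
      "dia n\<^sub>0 (\<alpha>\<^sub>0 + 1) Top \<^bold>\<and> dia n \<alpha> Top \<equiv>\<^sub>T \<phi>'"
      using monomial_conj_lead[OF mnf_lead.base[OF base.prems] 3] by blast
    have "dia n \<alpha> (dia n\<^sub>0 \<alpha>\<^sub>0 Top) \<equiv>\<^sub>T dia n \<alpha> (dia n\<^sub>0 \<alpha>\<^sub>0 Top \<^bold>\<and> Top)"
      by (intro tsc_equiv_dia tsc_equiv_conj_Top dia_Top_Fm)
    also have "\<dots> \<equiv>\<^sub>T dia n\<^sub>0 (\<alpha>\<^sub>0 + 1) Top \<^bold>\<and> dia n \<alpha> Top"
      by (intro dia_above_monomial Fm.intros 3 base.prems)
    also note *(3)
    finally show ?thesis using * by (meson min.coboundedI2)
  qed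
next
  case (step n\<^sub>1 \<alpha>\<^sub>1 \<chi> n\<^sub>0 \<alpha>\<^sub>0 \<beta>)
  note lead = mnf_lead.step[OF step.hyps]
  consider "n < n\<^sub>0" | "n = n\<^sub>0" | "n\<^sub>0 < n" by linarith
  then show ?case
  proof cases
    case 1
    then obtain \<mu> \<phi>' where "mnf_lead n \<mu> \<phi>'" "dia n \<alpha> (dia n\<^sub>0 \<alpha>\<^sub>0 Top \<^bold>\<and> \<chi>) \<equiv>\<^sub>T \<phi>'"
      using dia_below_lead[OF lead _ step.prems] by blast
    then show ?thesis by (meson min.cobounded1)
  next
    case 2
    \<comment> \<open>Since \<open>2 + \<beta> = 1 + (1 + \<beta>)\<close>, the leading monomial is
      the Schmerl image of exponent \<open>1 + \<beta>\<close>.\<close>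
    have "dia n (1 + \<beta>) \<chi> \<equiv>\<^sub>T dia n\<^sub>0 \<alpha>\<^sub>0 Top \<^bold>\<and> \<chi>"
      using schmerl_equiv[OF step.hyps(1,2), of "1 + \<beta>"] step.hyps(3) 2
      by (simp add: ordE_two_add)
    then have "dia n \<alpha> (dia n\<^sub>0 \<alpha>\<^sub>0 Top \<^bold>\<and> \<chi>) \<equiv>\<^sub>T dia n \<alpha> (dia n (1 + \<beta>) \<chi>)"
      by (rule tsc_equiv_dia[OF tsc_equiv_sym])
    also have "\<dots> \<equiv>\<^sub>T dia n (1 + \<beta> + \<alpha>) \<chi>"
      by (intro tsc_equiv_coadd mnf_lead_Fm[OF step.hyps(1)])
    finally have equiv: "dia n \<alpha> (dia n\<^sub>0 \<alpha>\<^sub>0 Top \<^bold>\<and> \<chi>) \<equiv>\<^sub>T dia n (1 + \<beta> + \<alpha>) \<chi>" .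
    have "0 < 1 + \<beta> + \<alpha>" by (intro ordE_add_pos_left ordE_one_pos)
    then obtain \<mu> \<phi>' where "mnf_lead n \<mu> \<phi>'" "dia n (1 + \<beta> + \<alpha>) \<chi> \<equiv>\<^sub>T \<phi>'"
      using dia_below_lead[OF step.hyps(1)] step.hyps(2) 2 by blast
    then show ?thesis using tsc_equiv_trans[OF equiv] by (meson min.cobounded1)
  next
    case 3
    obtain m \<mu> \<chi>' where IH: "mnf_lead m \<mu> \<chi>'" "min n n\<^sub>1 \<le> m" "dia n \<alpha> \<chi> \<equiv>\<^sub>T \<chi>'"
      using step.IH step.prems by blast
    with 3 step.hyps(2) have "n\<^sub>0 < m" by linarith
    then obtain m' \<mu>' \<phi>' where *: "mnf_lead m' \<mu>' \<phi>'" "n\<^sub>0 \<le> m'"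
      "dia n\<^sub>0 (\<alpha>\<^sub>0 + 1) Top \<^bold>\<and> \<chi>' \<equiv>\<^sub>T \<phi>'"
      using monomial_conj_lead[OF IH(1)] by blast
    have "dia n \<alpha> (dia n\<^sub>0 \<alpha>\<^sub>0 Top \<^bold>\<and> \<chi>) \<equiv>\<^sub>T dia n\<^sub>0 (\<alpha>\<^sub>0 + 1) Top \<^bold>\<and> dia n \<alpha> \<chi>"
      by (intro dia_above_monomial mnf_lead_Fm[OF step.hyps(1)] 3 step.prems)
    also have "\<dots> \<equiv>\<^sub>T dia n\<^sub>0 (\<alpha>\<^sub>0 + 1) Top \<^bold>\<and> \<chi>'"
      by (intro tsc_equiv_conj tsc_equiv_refl dia_Top_Fm IH(3))
    also note *(3)
    finally show ?thesis using * by (meson min.coboundedI2)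
  qed
qed

theorem theorem5p9:
  fixes \<psi> :: fm and n :: nat and \<alpha> :: ordE
  assumes "\<psi> \<in> MNF"
  shows "\<exists>\<psi>' \<in> MNF. dia n \<alpha> \<psi> \<equiv>\<^sub>T \<psi>'"
proof (cases "\<alpha> = 0")
  case True
  then show ?thesis using assms MNF_subset_Fm by (auto intro!: bexI[of _ \<psi>] tsc_equiv_refl)
next
  case False
  then have "0 < \<alpha>" by (simp add: ordE_pos_iff)
  from MNF_cases_lead[OF assms] consider "\<psi> \<equiv>\<^sub>T Top" | n\<^sub>0 \<alpha>\<^sub>0 where "mnf_lead n\<^sub>0 \<alpha>\<^sub>0 \<psi>"
    by blast
  then show ?thesis
  proof cases
    case 1
    then show ?thesis by (intro bexI[of _ "dia n \<alpha> Top"] tsc_equiv_dia MNF.monomial)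
  next
    case 2
    then show ?thesis using dia_mnf_lead[OF _ \<open>0 < \<alpha>\<close>] mnf_lead_MNF by blast
  qed
qed

end
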